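(* The $k^*$-means algorithm (defined in the context) is guaranteed to converge in finite time.
   Context: Data. $X$ is a finite set of $N=|X|$ data points in $\mathbb{R}^d$. For a finite set $S$ of points, $Q(S)=\sum_{x\in S}\|x-\bar S\|^2$, where $\bar S$ is the mean of $S$ (total sum of squares). Objective. $k^*$-means is designed to minimise the description length (MDL cost), in bits, of the data under a clustering: over partitions $P$ of $X$, and up to an additive constant, $|P|dm+N\log|P|+\frac12\sum_{S\in P}Q(S)$, where $m$ is the floating point precision determined from the data. State. The algorithm maintains a number $k$ of clusters partitioning $X$, a centroid for each cluster, and, for each cluster, a partition of it into two subclusters together with two subcentroids. Initialisation. There is a single cluster containing all of $X$, with centroid the mean of $X$. Two subcentroids are initialised by the $k$-means++ seeding method, and each point is put in the subcluster of the nearer subcentroid. $k$-means step. This consists of an assign step followed by an update step. Assign: each point is assigned to the cluster of its nearest centroid (a point counts as reassigned only if it is closer to its new centroid than to its old one). Update: each centroid is replaced by the mean of the points assigned to its cluster. The same two operations are applied, within each cluster, to its subclusters and subcentroids. Maybe-split. For each cluster $S$ with subclusters $S_1,S_2$ and subcentroids $c_1,c_2$, and with $\mu$ the centroid of $S$ and $k$ the current number of clusters, compute the cost change $$\sum_{x\in S_1}\|x-c_1\|^2+\sum_{x\in S_2}\|x-c_2\|^2-\sum_{x\in S}\|x-\mu\|^2+\frac{N}{k+1}.$$ If the smallest of these values over all clusters is $<0$, the cluster attaining it is split: its two subclusters, with their subcentroids, become full clusters with centroids, and new subcentroids and subclusters are initialised within each of them by the $k$-means++ method. Otherwise no cluster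 is split. Maybe-merge. Take the pair of clusters $S_1,S_2$ whose centroids $\mu_1,\mu_2$ are closest, let $Z=S_1\cup S_2$ with mean $\bar Z$, let $k$ be the current number of clusters, and compute the cost change $$\sum_{z\in Z}\|z-\bar Z\|^2-\Big(\sum_{x\in S_1}\|x-\mu_1\|^2+\sum_{x\in S_2}\|x-\mu_2\|^2\Big)-\frac{N}{k}.$$ If it is $<0$, the two clusters are merged: they are replaced by the cluster $Z$ with centroid $\bar Z$, their own subclusters are discarded, and $S_1,S_2$ become the two subclusters of $Z$. The $k^*$-means algorithm. After initialisation, repeat the following cycle: perform a $k$-means step; perform maybe-split; if no cluster was split, perform another $k$-means step and then maybe-merge. The algorithm stops when the assignment of points to clusters remains unchanged for a full cycle. *)

theory Defs
  imports "HOL-Probability.Probability"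
begin

definition mean :: "'a::euclidean_space set \<Rightarrow> 'a" where
  "mean S = (\<Sum>x\<in>S. x) /\<^sub>R real (card S)"

definition sse :: "'a::euclidean_space set \<Rightarrow> 'a \<Rightarrow> real" where
  "sse S c = (\<Sum>x\<in>S. (norm (x - c))\<^sup>2)"

(* k-means++ seeding with two seeds: the first is uniform on S, the second is drawn with
   probability proportional to the squared distance to the first.  If S has no other point,
   all weights vanish and the second seed can only be the first one again. *)

definition kmeanspp_second :: "'a::euclidean_space set \<Rightarrow> 'a \<Rightarrow> 'a pmf" where
  "kmeanspp_second S c =
     (if S \<subseteq> {c} then return_pmf c
      else embed_pmf (\<lambda>y. if y \<in> S then (norm (y - c))\<^sup>2 / (\<Sum>z\<in>S. (norm (z - c))\<^sup>2) else 0))"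

definition kmeanspp :: "'a::euclidean_space set \<Rightarrow> ('a \<times> 'a) pmf" where
  "kmeanspp S =
     bind_pmf (pmf_of_set S) (\<lambda>c1. map_pmf (\<lambda>c2. (c1, c2)) (kmeanspp_second S c1))"

(* The clusters are named by the finite set of labels; k is the number of labels.
   The label and sub fields matter only on the data points, the centroid and subcentroid
   fields only on labels in use.  The two subclusters of a cluster are indexed by bool. *)

record 'a state =
  labels :: "nat set"
  label :: "'a \<Rightarrow> nat"
  centroid :: "nat \<Rightarrow> 'a"
  sub :: "'a \<Rightarrow> bool"
  subcentroid :: "nat \<Rightarrow> bool \<Rightarrow> 'a"

definition cluster :: "'a set \<Rightarrow> 'a state \<Rightarrow> nat \<Rightarrow> 'a set" where
  "cluster X s j = {x \<in> X. label s x = j}"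

definition subcluster :: "'a set \<Rightarrow> 'a state \<Rightarrow> nat \<Rightarrow> bool \<Rightarrow> 'a set" where
  "subcluster X s j b = {x \<in> X. label s x = j \<and> sub s x = b}"

(* All random choices and all ties are modelled as nondeterminism: the steps below are
   relations that admit every outcome of positive probability and every way of breaking a tie. *)

definition sub_seeded :: "'a::euclidean_space set \<Rightarrow> ('a \<Rightarrow> bool) \<Rightarrow> (bool \<Rightarrow> 'a) \<Rightarrow> bool" where
  "sub_seeded S p c \<longleftrightarrow>
     (c False, c True) \<in> set_pmf (kmeanspp S) \<and>
     (\<forall>x\<in>S. \<forall>b. dist x (c (p x)) \<le> dist x (c b))"

definition initial :: "'a::euclidean_space set \<Rightarrow> 'a state \<Rightarrow> bool" where
  "initial X s \<longleftrightarrow>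
     labels s = {0} \<and> (\<forall>x\<in>X. label s x = 0) \<and> centroid s 0 = mean X \<and>
     sub_seeded X (sub s) (subcentroid s 0)"

(* A point that has just entered a cluster has no old subcluster there, so it simply goes to a
   nearest subcentroid. *)

definition assign_step :: "'a::euclidean_space set \<Rightarrow> 'a state \<Rightarrow> 'a state \<Rightarrow> bool" where
  "assign_step X s s' \<longleftrightarrow>
     labels s' = labels s \<and> centroid s' = centroid s \<and> subcentroid s' = subcentroid s \<and>
     (\<forall>x\<in>X.
        label s' x \<in> labels s \<and>
        (\<forall>j\<in>labels s. dist x (centroid s (label s' x)) \<le> dist x (centroid s j)) \<and>
        (label s' x \<noteq> label s x \<longrightarrow>
           dist x (centroid s (label s' x)) < dist x (centroid s (label s x)))) \<and>
     (\<forall>x\<in>X. let c = subcentroid s (label s' x) in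
        (\<forall>b. dist x (c (sub s' x)) \<le> dist x (c b)) \<and>
        (label s' x = label s x \<and> sub s' x \<noteq> sub s x \<longrightarrow>
           dist x (c (sub s' x)) < dist x (c (sub s x))))"

(* An empty set has no mean.  A cluster that has lost all its points may either be discarded or
   survive with an arbitrary centroid, so that every convention for this case is covered;
   the subcentroid of an empty subcluster is likewise arbitrary. *)

definition update_step :: "'a::euclidean_space set \<Rightarrow> 'a state \<Rightarrow> 'a state \<Rightarrow> bool" where
  "update_step X s s' \<longleftrightarrow>
     label s' = label s \<and> sub s' = sub s \<and> labels s' \<subseteq> labels s \<and>
     (\<forall>j\<in>labels s. cluster X s j \<noteq> {} \<longrightarrow>
        j \<in> labels s' \<and> centroid s' j = mean (cluster X s j)) \<and>
     (\<forall>j\<in>labels s'. \<forall>b. subcluster X s j b \<noteq> {} \<longrightarrow>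
        subcentroid s' j b = mean (subcluster X s j b))"

definition kmeans_step :: "'a::euclidean_space set \<Rightarrow> 'a state \<Rightarrow> 'a state \<Rightarrow> bool" where
  "kmeans_step X s s' \<longleftrightarrow> (\<exists>t. assign_step X s t \<and> update_step X t s')"

definition split_change :: "'a::euclidean_space set \<Rightarrow> 'a state \<Rightarrow> nat \<Rightarrow> real" where
  "split_change X s j =
     sse (subcluster X s j False) (subcentroid s j False)
     + sse (subcluster X s j True) (subcentroid s j True)
     - sse (cluster X s j) (centroid s j)
     + real (card X) / (real (card (labels s)) + 1)"

(* Cluster j is split: its first subcluster keeps the label j, the second gets an unused
   label j'. *)

definition split_into ::
  "'a::euclidean_space set \<Rightarrow> nat \<Rightarrow> nat \<Rightarrow> 'a state \<Rightarrow> 'a state \<Rightarrow> bool" where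
  "split_into X j j' s s' \<longleftrightarrow>
     j' \<notin> labels s \<and> labels s' = insert j' (labels s) \<and>
     label s' = (\<lambda>x. if label s x = j \<and> sub s x then j' else label s x) \<and>
     centroid s' = (centroid s)(j := subcentroid s j False, j' := subcentroid s j True) \<and>
     (\<forall>x\<in>X. label s x \<noteq> j \<longrightarrow> sub s' x = sub s x) \<and>
     (\<forall>i\<in>labels s - {j}. subcentroid s' i = subcentroid s i) \<and>
     (\<forall>i\<in>{j, j'}. sub_seeded (cluster X s' i) (sub s') (subcentroid s' i))"

definition split_step :: "'a::euclidean_space set \<Rightarrow> 'a state \<Rightarrow> 'a state \<Rightarrow> bool" where
  "split_step X s s' \<longleftrightarrow>
     (\<exists>j\<in>labels s. (\<forall>i\<in>labels s. split_change X s j \<le> split_change X s i) \<and>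
        split_change X s j < 0 \<and> (\<exists>j'. split_into X j j' s s'))"

definition no_split :: "'a::euclidean_space set \<Rightarrow> 'a state \<Rightarrow> bool" where
  "no_split X s \<longleftrightarrow> (\<forall>j\<in>labels s. \<not> split_change X s j < 0)"

definition closest_pair :: "'a::euclidean_space state \<Rightarrow> nat \<Rightarrow> nat \<Rightarrow> bool" where
  "closest_pair s i j \<longleftrightarrow>
     i \<in> labels s \<and> j \<in> labels s \<and> i \<noteq> j \<and>
     (\<forall>i'\<in>labels s. \<forall>j'\<in>labels s. i' \<noteq> j' \<longrightarrow>
        dist (centroid s i) (centroid s j) \<le> dist (centroid s i') (centroid s j'))"

definition merge_change :: "'a::euclidean_space set \<Rightarrow> 'a state \<Rightarrow> nat \<Rightarrow> nat \<Rightarrow> real" where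
  "merge_change X s i j =
     (let Z = cluster X s i \<union> cluster X s j in
        sse Z (mean Z)
        - (sse (cluster X s i) (centroid s i) + sse (cluster X s j) (centroid s j))
        - real (card X) / real (card (labels s)))"

(* The union keeps the label i; the former centroids become its subcentroids. *)

definition merged :: "'a::euclidean_space set \<Rightarrow> nat \<Rightarrow> nat \<Rightarrow> 'a state \<Rightarrow> 'a state" where
  "merged X i j s =
     \<lparr>labels = labels s - {j},
      label = (\<lambda>x. if label s x = j then i else label s x),
      centroid = (centroid s)(i := mean (cluster X s i \<union> cluster X s j)),
      sub = (\<lambda>x. if label s x = i then False else if label s x = j then True else sub s x),
      subcentroid = (subcentroid s)(i := (\<lambda>b. if b then centroid s j else centroid s i))\<rparr>"

definition maybe_merge :: "'a::euclidean_space set \<Rightarrow> 'a state \<Rightarrow> 'a state \<Rightarrow> bool" where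
  "maybe_merge X s s' \<longleftrightarrow>
     (if card (labels s) < 2 then s' = s
      else \<exists>i j. closest_pair s i j \<and>
             s' = (if merge_change X s i j < 0 then merged X i j s else s))"

definition kstar_cycle :: "'a::euclidean_space set \<Rightarrow> 'a state \<Rightarrow> 'a state \<Rightarrow> bool" where
  "kstar_cycle X s s' \<longleftrightarrow>
     (\<exists>t. kmeans_step X s t \<and>
        (split_step X t s' \<or>
         no_split X t \<and> (\<exists>u. kmeans_step X t u \<and> maybe_merge X u s')))"

(* The stopping criterion for a cycle leading from s to s'. *)

definition assignment_unchanged :: "'a set \<Rightarrow> 'a state \<Rightarrow> 'a state \<Rightarrow> bool" where
  "assignment_unchanged X s s' \<longleftrightarrow> (\<forall>x\<in>X. label s' x = label s x)"

end

theory Submission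
  imports Defs
begin

text \<open>
  The potential \<open>\<Sum>\<^sub>x \<bar>x - c(x)\<bar>\<^sup>2 + N H\<^sub>k\<close>, where \<open>c(x)\<close> is the centroid of the cluster of \<open>x\<close>
  and \<open>H\<^sub>k\<close> is the \<open>k\<close>-th harmonic number, changes under a split or a merge by exactly the quantity
  whose sign the algorithm tests, because \<open>H\<^sub>k\<close> grows by \<open>1/(k+1)\<close> from \<open>k\<close> to \<open>k+1\<close>. It never
  increases in a \<open>k\<close>-means step, and drops strictly if a point is reassigned. So every cycle that
  changes the assignment lowers it. At the end of a cycle each nonempty cluster has its mean as
  centroid, so the potential is a function of the partition of \<open>X\<close> and of \<open>k\<close>; since \<open>H\<^sub>k\<close> is
  unbounded, \<open>k\<close> is bounded along a run, and only finitely many values of the potential can occur.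
\<close>

section \<open>Invariants of a run and the potential\<close>

definition well_labelled :: "'a set \<Rightarrow> 'a state \<Rightarrow> bool" where
  "well_labelled X s \<longleftrightarrow> finite (labels s) \<and> label s ` X \<subseteq> labels s"

text \<open>Quantifying over points rather than labels leaves out empty clusters, whose centroids
  may be arbitrary.\<close>

definition centred :: "'a::euclidean_space set \<Rightarrow> 'a state \<Rightarrow> bool" where
  "centred X s \<longleftrightarrow> (\<forall>x\<in>X. centroid s (label s x) = mean (cluster X s (label s x)))"

definition distortion :: "'a::euclidean_space set \<Rightarrow> 'a state \<Rightarrow> real" where
  "distortion X s = (\<Sum>x\<in>X. (norm (x - centroid s (label s x)))\<^sup>2)"

definition potential :: "'a::euclidean_space set \<Rightarrow> 'a state \<Rightarrow> real" where
  "potential X s = distortion X s + real (card X) * harm (card (labels s))"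

section \<open>Sums of squares and the distortion\<close>

text \<open>Expanding each square around the mean, the cross terms cancel because deviations from
  the mean sum to zero; what remains besides \<open>sse S (mean S)\<close> is a nonnegative multiple
  of the squared distance from the mean to \<open>c\<close>.\<close>

lemma sse_mean_le:
  fixes S :: "'a::euclidean_space set"
  assumes "finite S"
  shows "sse S (mean S) \<le> sse S c"
proof (cases "S = {}")
  case True
  then show ?thesis by (simp add: sse_def)
next
  case False
  define m where "m = mean S"
  have "(\<Sum>x\<in>S. x - m) = 0"
    using assms False by (simp add: sum_subtractf m_def mean_def sum_constant_scaleR)
  then have zero: "(\<Sum>x\<in>S. (x - m) \<bullet> (m - c)) = 0"
    by (simp flip: inner_sum_left)
  have "(norm (x - c))\<^sup>2 = (norm (x - m))\<^sup>2 + 2 * ((x - m) \<bullet> (m - c)) + (norm (m - c))\<^sup>2" for x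
    by (simp add: power2_norm_eq_inner inner_simps inner_commute)
  then have "sse S c =
      (\<Sum>x\<in>S. (norm (x - m))\<^sup>2 + 2 * ((x - m) \<bullet> (m - c)) + (norm (m - c))\<^sup>2)"
    unfolding sse_def by (intro sum.cong refl)
  also have "\<dots> = sse S m + 2 * (\<Sum>x\<in>S. (x - m) \<bullet> (m - c)) + real (card S) * (norm (m - c))\<^sup>2"
    by (simp add: sse_def sum.distrib sum_distrib_left)
  finally have "sse S c =
      sse S m + 2 * (\<Sum>x\<in>S. (x - m) \<bullet> (m - c)) + real (card S) * (norm (m - c))\<^sup>2" .
  with zero show ?thesis
    by (simp add: m_def)
qed

text \<open>The index set \<open>J\<close> is left free: splits and merges sum over all labels, the
  update step only over the labels in use.\<close>

lemma distortion_eq_sum_sse: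
  assumes "finite X" "finite J" "label s ` X \<subseteq> J"
  shows "distortion X s = (\<Sum>j\<in>J. sse (cluster X s j) (centroid s j))"
proof -
  have "distortion X s =
      (\<Sum>j\<in>J. \<Sum>x\<in>{x \<in> X. label s x = j}. (norm (x - centroid s (label s x)))\<^sup>2)"
    unfolding distortion_def using assms by (intro sum.group [symmetric]) auto
  then show ?thesis
    by (simp add: sse_def cluster_def)
qed

lemma distortion_nonneg: "0 \<le> distortion X s"
  by (simp add: distortion_def sum_nonneg)

section \<open>Preservation of well-labelledness\<close>

lemma well_labelled_initial: "initial X s \<Longrightarrow> well_labelled X s"
  by (auto simp: initial_def well_labelled_def)

lemma well_labelled_assign_step:
  "assign_step X s t \<Longrightarrow> well_labelled X s \<Longrightarrow> well_labelled X t"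
  by (auto simp: assign_step_def well_labelled_def)

text \<open>Only empty clusters can be discarded, so the label of a data point survives.\<close>

lemma well_labelled_update_step:
  assumes "update_step X s t" "well_labelled X s"
  shows "well_labelled X t"
proof -
  have "label s x \<in> labels t" if "x \<in> X" for x
    using assms that unfolding update_step_def well_labelled_def cluster_def by blast
  with assms show ?thesis
    by (auto simp: update_step_def well_labelled_def intro: finite_subset)
qed

lemma well_labelled_kmeans_step:
  "kmeans_step X s t \<Longrightarrow> well_labelled X s \<Longrightarrow> well_labelled X t"
  unfolding kmeans_step_def
  using well_labelled_assign_step well_labelled_update_step by blast

lemma well_labelled_split_into:
  "split_into X j j' s t \<Longrightarrow> well_labelled X s \<Longrightarrow> well_labelled X t"
  by (auto simp: split_into_def well_labelled_def)

lemma well_labelled_merged: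
  "i \<in> labels s \<Longrightarrow> i \<noteq> j \<Longrightarrow> well_labelled X s \<Longrightarrow> well_labelled X (merged X i j s)"
  by (auto simp: merged_def well_labelled_def)

lemma well_labelled_maybe_merge:
  assumes "maybe_merge X s t" "well_labelled X s"
  shows "well_labelled X t"
proof (cases "t = s")
  case False
  with assms(1) obtain i j where "closest_pair s i j" "t = merged X i j s"
    unfolding maybe_merge_def by metis
  with assms(2) show ?thesis
    by (auto simp: closest_pair_def intro!: well_labelled_merged)
qed (use assms in simp)

lemma well_labelled_kstar_cycle:
  "kstar_cycle X s t \<Longrightarrow> well_labelled X s \<Longrightarrow> well_labelled X t"
  unfolding kstar_cycle_def split_step_def
  using well_labelled_kmeans_step well_labelled_split_into well_labelled_maybe_merge by blast

section \<open>Every step has an outcome\<close>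

text \<open>Any pmf has nonempty support, so a seed pair exists even for empty \<open>S\<close>;
  this covers splits that leave one part without points.\<close>

lemma sub_seeded_exists:
  fixes S :: "'a::euclidean_space set"
  shows "\<exists>p c. sub_seeded S p c"
proof -
  obtain c1 c2 where c: "(c1, c2) \<in> set_pmf (kmeanspp S)"
    using set_pmf_not_empty [of "kmeanspp S"] by auto
  define c' where "c' = (\<lambda>b. if b then c2 else c1)"
  have "sub_seeded S (\<lambda>x. dist x c2 \<le> dist x c1) c'"
    using c by (auto simp: sub_seeded_def c'_def)
  then show ?thesis by blast
qed

lemma sub_seeded_cong:
  "(\<And>x. x \<in> S \<Longrightarrow> p x = q x) \<Longrightarrow> sub_seeded S p c \<longleftrightarrow> sub_seeded S q c"
  by (simp add: sub_seeded_def)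

lemma initial_exists:
  fixes X :: "'a::euclidean_space set"
  shows "\<exists>s. initial X s"
proof -
  obtain p c where "sub_seeded X p c"
    using sub_seeded_exists by blast
  then have "initial X \<lparr>labels = {0}, label = (\<lambda>_. 0), centroid = (\<lambda>_. mean X),
      sub = p, subcentroid = (\<lambda>_. c)\<rparr>"
    by (simp add: initial_def)
  then show ?thesis ..
qed

text \<open>The old index \<open>a\<close> is kept whenever it is itself a minimiser, as the assign step requires.\<close>

lemma reassignment_exists:
  fixes f :: "'i \<Rightarrow> real"
  assumes "finite A" "a \<in> A"
  shows "\<exists>b\<in>A. (\<forall>j\<in>A. f b \<le> f j) \<and> (b \<noteq> a \<longrightarrow> f b < f a)"
proof (cases "\<forall>j\<in>A. f a \<le> f j")
  case False
  obtain b where "b \<in> A" "\<forall>j\<in>A. f b \<le> f j"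
    using ex_min_if_finite [of "f ` A"] assms by (auto simp: not_less)
  with False show ?thesis
    by (meson order.trans not_less)
qed (use assms in blast)

lemma assign_step_exists:
  fixes X :: "'a::euclidean_space set"
  assumes "well_labelled X s"
  shows "\<exists>t. assign_step X s t"
proof -
  have "\<exists>b\<in>labels s. (\<forall>j\<in>labels s. dist x (centroid s b) \<le> dist x (centroid s j)) \<and>
      (b \<noteq> label s x \<longrightarrow> dist x (centroid s b) < dist x (centroid s (label s x)))" if "x \<in> X" for x
    using assms that by (intro reassignment_exists) (auto simp: well_labelled_def)
  then obtain l where l: "\<And>x. x \<in> X \<Longrightarrow> l x \<in> labels s \<and>
      (\<forall>j\<in>labels s. dist x (centroid s (l x)) \<le> dist x (centroid s j)) \<and>
      (l x \<noteq> label s x \<longrightarrow> dist x (centroid s (l x)) < dist x (centroid s (label s x)))"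
    by metis
  \<comment> \<open>The subcentroids are those of the new label \<open>l x\<close>. Preferring the
    old value \<open>sub s x\<close> even after a change of label is one of the allowed
    choices.\<close>
  have "\<exists>b\<in>UNIV. (\<forall>b'\<in>UNIV. dist x (subcentroid s (l x) b) \<le> dist x (subcentroid s (l x) b')) \<and>
      (b \<noteq> sub s x \<longrightarrow>
        dist x (subcentroid s (l x) b) < dist x (subcentroid s (l x) (sub s x)))" for x
    by (intro reassignment_exists) auto
  then obtain p where p: "\<And>x. (\<forall>b'. dist x (subcentroid s (l x) (p x)) \<le>
        dist x (subcentroid s (l x) b')) \<and>
      (p x \<noteq> sub s x \<longrightarrow>
        dist x (subcentroid s (l x) (p x)) < dist x (subcentroid s (l x) (sub s x)))"
    by (metis UNIV_I)
  have "\<forall>x\<in>X. let c = subcentroid s (l x) in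
      (\<forall>b. dist x (c (p x)) \<le> dist x (c b)) \<and>
      (l x = label s x \<and> p x \<noteq> sub s x \<longrightarrow> dist x (c (p x)) < dist x (c (sub s x)))"
    using p unfolding Let_def by blast
  with l have "assign_step X s (s\<lparr>label := l, sub := p\<rparr>)"
    by (simp add: assign_step_def)
  then show ?thesis ..
qed

lemma update_step_exists: "\<exists>t. update_step X s t"
proof -
  have "update_step X s (s\<lparr>centroid := (\<lambda>j. mean (cluster X s j)),
      subcentroid := (\<lambda>j b. mean (subcluster X s j b))\<rparr>)"
    by (simp add: update_step_def)
  then show ?thesis ..
qed

lemma kmeans_step_exists: "well_labelled X s \<Longrightarrow> \<exists>t. kmeans_step X s t"
  unfolding kmeans_step_def using assign_step_exists update_step_exists by blast

text \<open>Finitely many labels leave a fresh one. The two new clusters are seeded independently,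
  and the seedings are glued along the new labels, as the clusters are disjoint.\<close>

lemma split_into_exists:
  fixes X :: "'a::euclidean_space set"
  assumes "well_labelled X s" "j \<in> labels s"
  shows "\<exists>j' t. split_into X j j' s t"
proof -
  obtain j' where j': "j' \<notin> labels s"
    using assms ex_new_if_finite [OF infinite_UNIV_nat, of "labels s"]
    unfolding well_labelled_def by blast
  define l where "l = (\<lambda>x. if label s x = j \<and> sub s x then j' else label s x)"
  have "\<exists>p c. sub_seeded {x \<in> X. l x = i} p c" for i
    by (rule sub_seeded_exists)
  then obtain p c where pc: "\<And>i. sub_seeded {x \<in> X. l x = i} (p i) (c i)"
    by metis
  define t where "t = \<lparr>labels = insert j' (labels s), label = l,
    centroid = (centroid s)(j := subcentroid s j False, j' := subcentroid s j True),
    sub = (\<lambda>x. if label s x = j then p (l x) x else sub s x),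
    subcentroid = (\<lambda>i. if i \<in> {j, j'} then c i else subcentroid s i)\<rparr>"
  have seeded: "sub_seeded (cluster X t i) (sub t) (subcentroid t i)" if "i \<in> {j, j'}" for i
  proof -
    have "sub t x = p i x" if "x \<in> cluster X t i" for x
      using that \<open>i \<in> {j, j'}\<close> assms j'
      by (auto simp: t_def cluster_def well_labelled_def l_def split: if_splits)
    then have "sub_seeded (cluster X t i) (sub t) (c i) \<longleftrightarrow> sub_seeded (cluster X t i) (p i) (c i)"
      by (rule sub_seeded_cong)
    with pc [of i] that show ?thesis
      by (auto simp: t_def cluster_def)
  qed
  have "split_into X j j' s t"
    unfolding split_into_def
  proof (intro conjI)
    show "\<forall>i\<in>{j, j'}. sub_seeded (cluster X t i) (sub t) (subcentroid t i)"
      using seeded by blast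
  qed (use j' in \<open>auto simp: t_def l_def\<close>)
  then show ?thesis by blast
qed

lemma split_step_exists:
  fixes X :: "'a::euclidean_space set"
  assumes "well_labelled X s" "\<not> no_split X s"
  shows "\<exists>t. split_step X s t"
proof -
  obtain i where i: "i \<in> labels s" "split_change X s i < 0"
    using assms by (auto simp: no_split_def)
  \<comment> \<open>Here \<open>reassignment_exists\<close> serves only to supply a minimiser;
    \<open>i\<close> shows that there is a label to choose from.\<close>
  then obtain j where j: "j \<in> labels s" "\<forall>i\<in>labels s. split_change X s j \<le> split_change X s i"
    using reassignment_exists [of "labels s" i "split_change X s"] assms
    by (auto simp: well_labelled_def)
  then have "split_change X s j < 0"
    using i by force
  with j split_into_exists [OF assms(1) j(1)] show ?thesis
    unfolding split_step_def by blast
qed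

lemma maybe_merge_exists:
  fixes X :: "'a::euclidean_space set"
  assumes "well_labelled X s"
  shows "\<exists>t. maybe_merge X s t"
proof (cases "card (labels s) < 2")
  case False
  \<comment> \<open>A closest pair is a minimiser over this finite set, which is nonempty once there
    are two labels.\<close>
  define A where "A = {p \<in> labels s \<times> labels s. fst p \<noteq> snd p}"
  have "finite A"
    using assms by (auto simp: A_def well_labelled_def)
  moreover have "\<exists>a. a \<in> A"
    using False card_le_Suc0_iff_eq [of "labels s"] assms
    by (fastforce simp: A_def well_labelled_def)
  ultimately obtain p where "p \<in> A" "\<forall>q\<in>A. dist (centroid s (fst p)) (centroid s (snd p))
      \<le> dist (centroid s (fst q)) (centroid s (snd q))"
    using reassignment_exists [of A _ "\<lambda>q. dist (centroid s (fst q)) (centroid s (snd q))"]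
    by blast
  then have "closest_pair s (fst p) (snd p)"
    by (auto simp: A_def closest_pair_def)
  with False show ?thesis
    by (auto simp: maybe_merge_def)
qed (auto simp: maybe_merge_def)

lemma kstar_cycle_exists:
  fixes X :: "'a::euclidean_space set"
  assumes "well_labelled X s"
  shows "\<exists>t. kstar_cycle X s t"
proof -
  obtain t where t: "kmeans_step X s t"
    using assms kmeans_step_exists by blast
  then have wt: "well_labelled X t"
    using assms well_labelled_kmeans_step by blast
  show ?thesis
  proof (cases "no_split X t")
    case True
    obtain u where u: "kmeans_step X t u"
      using wt kmeans_step_exists by blast
    then obtain v where "maybe_merge X u v"
      using maybe_merge_exists wt well_labelled_kmeans_step by blast
    with t u True show ?thesis
      unfolding kstar_cycle_def by blast
  next
    case False
    with t split_step_exists [OF wt] show ?thesis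
      unfolding kstar_cycle_def by blast
  qed
qed

section \<open>The potential under \<open>k\<close>-means steps\<close>

text \<open>The centroids stay fixed, so the sums compare term by term. Strictness comes from the
  rule that a point moves only to a strictly closer centroid, which rules out endless swapping at
  ties.\<close>

lemma distortion_assign_step:
  assumes "finite X" "assign_step X s t"
  shows "distortion X t \<le> distortion X s"
    and "\<exists>x\<in>X. label t x \<noteq> label s x \<Longrightarrow> distortion X t < distortion X s"
proof -
  have [simp]: "centroid t = centroid s"
    using assms by (simp add: assign_step_def)
  have less: "(norm (x - centroid s (label t x)))\<^sup>2 < (norm (x - centroid s (label s x)))\<^sup>2"
    if "x \<in> X" "label t x \<noteq> label s x" for x
    using assms that by (auto simp: assign_step_def dist_norm intro!: power_strict_mono)
  then have le: "(norm (x - centroid s (label t x)))\<^sup>2 \<le> (norm (x - centroid s (label s x)))\<^sup>2"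
    if "x \<in> X" for x
    by (cases "label t x = label s x") (simp, rule less_imp_le [OF less [OF that]])
  show "distortion X t \<le> distortion X s"
    unfolding distortion_def using le by (auto intro!: sum_mono)
  show "distortion X t < distortion X s" if "\<exists>x\<in>X. label t x \<noteq> label s x"
    unfolding distortion_def using that less le assms by (auto intro!: sum_strict_mono_ex1)
qed

lemma centred_update_step:
  assumes "update_step X s t" "well_labelled X s"
  shows "centred X t"
  unfolding centred_def
proof
  fix x assume x: "x \<in> X"
  have t: "label t = label s" "cluster X t = cluster X s"
    using assms by (auto simp: update_step_def cluster_def fun_eq_iff)
  have "label s x \<in> labels s" "cluster X s (label s x) \<noteq> {}"
    using assms x by (auto simp: well_labelled_def cluster_def)
  with assms(1) show "centroid t (label t x) = mean (cluster X t (label t x))"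
    unfolding t by (simp add: update_step_def)
qed

lemma distortion_update_step:
  assumes "finite X" "update_step X s t" "well_labelled X s"
  shows "distortion X t \<le> distortion X s"
proof -
  \<comment> \<open>Restricting to labels in use ensures that every new centroid in the sum is a
    mean, so \<open>sse_mean_le\<close> applies to each cluster.\<close>
  let ?J = "label s ` X"
  have lab: "label t = label s" and clu: "cluster X t = cluster X s"
    using assms by (auto simp: update_step_def cluster_def fun_eq_iff)
  have "centroid t j = mean (cluster X s j)" if "j \<in> ?J" for j
    using centred_update_step [OF assms(2,3)] that by (auto simp: centred_def lab clu)
  then have "distortion X t = (\<Sum>j\<in>?J. sse (cluster X s j) (mean (cluster X s j)))"
    using distortion_eq_sum_sse [of X ?J t] assms by (simp add: lab clu)
  also have "\<dots> \<le> (\<Sum>j\<in>?J. sse (cluster X s j) (centroid s j))"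
    using assms by (intro sum_mono sse_mean_le) (simp add: cluster_def)
  also have "\<dots> = distortion X s"
    using distortion_eq_sum_sse [of X ?J s] assms by simp
  finally show ?thesis .
qed

text \<open>The last claim prepares for splits, where subcentroids are promoted to
  centroids.\<close>

lemma kmeans_step_properties:
  assumes "finite X" "kmeans_step X s t" "well_labelled X s"
  shows "centred X t"
    and "potential X t \<le> potential X s"
    and "\<exists>x\<in>X. label t x \<noteq> label s x \<Longrightarrow> potential X t < potential X s"
    and "\<And>j b. j \<in> labels t \<Longrightarrow> subcluster X t j b \<noteq> {} \<Longrightarrow>
      subcentroid t j b = mean (subcluster X t j b)"
proof -
  obtain u where u: "assign_step X s u" "update_step X u t"
    using assms by (auto simp: kmeans_step_def)
  have wu: "well_labelled X u"
    using u assms well_labelled_assign_step by blast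
  show "centred X t"
    using centred_update_step u wu by blast
  \<comment> \<open>Discarding empty clusters can only lower \<open>k\<close>, and with it the
    harmonic term.\<close>
  have "labels t \<subseteq> labels s"
    using u by (auto simp: assign_step_def update_step_def)
  then have "card (labels t) \<le> card (labels s)"
    using assms by (intro card_mono) (auto simp: well_labelled_def)
  then have harm: "real (card X) * harm (card (labels t)) \<le> real (card X) * harm (card (labels s))"
    by (intro mult_left_mono harm_mono) auto
  have upd: "distortion X t \<le> distortion X u" "label t = label u"
    using distortion_update_step [OF assms(1) u(2) wu] u(2) by (auto simp: update_step_def)
  show "potential X t \<le> potential X s"
    using distortion_assign_step(1) [OF assms(1) u(1)] upd harm by (simp add: potential_def)
  show "potential X t < potential X s" if "\<exists>x\<in>X. label t x \<noteq> label s x"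
    using distortion_assign_step(2) [OF assms(1) u(1)] that upd harm by (simp add: potential_def)
  show "subcentroid t j b = mean (subcluster X t j b)"
    if "j \<in> labels t" "subcluster X t j b \<noteq> {}" for j b
  proof -
    have "subcluster X t j b = subcluster X u j b"
      using u(2) by (simp add: update_step_def subcluster_def)
    with u(2) that show ?thesis
      by (simp add: update_step_def)
  qed
qed

section \<open>The potential and centredness under splits and merges\<close>

text \<open>Only the summands of \<open>j\<close> and \<open>j'\<close> differ from before, and the
  harmonic term grows by exactly the penalty in \<open>split_change\<close>.\<close>

lemma potential_split_into:
  fixes X :: "'a::euclidean_space set"
  assumes "finite X" "well_labelled X s" "j \<in> labels s" "split_into X j j' s t"
  shows "potential X t = potential X s + split_change X s j"
proof -
  let ?L = "labels s - {j}"
  let ?f = "\<lambda>s i. sse (cluster X s i) (centroid s i)"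
  have fin: "finite (labels s)" and j': "j' \<notin> labels s" "j \<noteq> j'"
    and labels: "labels t = insert j' (labels s)"
    using assms by (auto simp: split_into_def well_labelled_def)
  \<comment> \<open>Since \<open>j'\<close> is fresh, no data point carried it before, so its
    cluster consists of the points split off from \<open>j\<close>.\<close>
  have clusters: "cluster X t j = subcluster X s j False" "cluster X t j' = subcluster X s j True"
    "\<And>i. i \<in> ?L \<Longrightarrow> cluster X t i = cluster X s i"
    using assms j' by (auto simp: split_into_def cluster_def subcluster_def well_labelled_def)
  have centroids: "centroid t j = subcentroid s j False" "centroid t j' = subcentroid s j True"
    "\<And>i. i \<in> ?L \<Longrightarrow> centroid t i = centroid s i"
    using assms j' by (auto simp: split_into_def)
  have "distortion X t = sum (?f t) (insert j' (labels s))"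
    using distortion_eq_sum_sse [of X "labels t" t] well_labelled_split_into [OF assms(4,2)] assms
    by (simp add: well_labelled_def labels)
  also have "\<dots> = ?f t j' + ?f t j + sum (?f t) ?L"
    using fin j' sum.remove [OF fin assms(3), of "?f t"] by simp
  also have "sum (?f t) ?L = sum (?f s) ?L"
    by (simp add: clusters centroids)
  also have "sum (?f s) ?L = distortion X s - ?f s j"
    using distortion_eq_sum_sse [of X "labels s" s] assms by (simp add: well_labelled_def sum_diff1)
  finally have "distortion X t = distortion X s + split_change X s j
      - real (card X) / (real (card (labels s)) + 1)"
    by (simp add: split_change_def clusters centroids)
  then show ?thesis
    using fin j' by (simp add: potential_def labels harm_Suc field_simps)
qed

text \<open>A point of a new cluster witnesses that the subcluster it came from is nonempty, so the
  promoted subcentroid is its mean.\<close>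

lemma centred_split_into:
  assumes "well_labelled X s" "centred X s" "j \<in> labels s" "split_into X j j' s t"
    and sub: "\<And>b. subcluster X s j b \<noteq> {} \<Longrightarrow> subcentroid s j b = mean (subcluster X s j b)"
  shows "centred X t"
  unfolding centred_def
proof
  fix x assume x: "x \<in> X"
  have "j \<noteq> j'"
    using assms by (auto simp: split_into_def)
  have lab: "label t = (\<lambda>x. if label s x = j \<and> sub s x then j' else label s x)"
    and cen: "centroid t = (centroid s)(j := subcentroid s j False, j' := subcentroid s j True)"
    using assms by (auto simp: split_into_def)
  have old: "label s y \<noteq> j'" if "y \<in> X" for y
    using assms that by (auto simp: split_into_def well_labelled_def)
  show "centroid t (label t x) = mean (cluster X t (label t x))"
  proof (cases "label s x = j")
    case True
    have "cluster X t (label t x) = subcluster X s j (sub s x)"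
      using True old \<open>j \<noteq> j'\<close> by (auto simp: cluster_def subcluster_def lab)
    moreover have "centroid t (label t x) = subcentroid s j (sub s x)"
      using True \<open>j \<noteq> j'\<close> by (simp add: cen lab)
    moreover have "x \<in> subcluster X s j (sub s x)"
      using True x by (simp add: subcluster_def)
    ultimately show ?thesis
      using sub by auto
  next
    case False
    have "cluster X t (label t x) = cluster X s (label s x)"
      using False old [OF x] by (auto simp: cluster_def lab)
    with False old [OF x] x assms(2) show ?thesis
      by (simp add: cen lab centred_def)
  qed
qed

lemma potential_merged:
  fixes X :: "'a::euclidean_space set"
  assumes "finite X" "well_labelled X s" "i \<in> labels s" "j \<in> labels s" "i \<noteq> j"
  shows "potential X (merged X i j s) = potential X s + merge_change X s i j"
proof -
  let ?t = "merged X i j s" and ?L = "labels s - {i, j}"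
  let ?f = "\<lambda>s i. sse (cluster X s i) (centroid s i)"
  have fin: "finite (labels s)"
    using assms by (simp add: well_labelled_def)
  have cl_i: "cluster X ?t i = cluster X s i \<union> cluster X s j"
    using assms by (auto simp: merged_def cluster_def)
  have rest: "?f ?t l = ?f s l" if "l \<in> ?L" for l
  proof -
    have "cluster X ?t l = cluster X s l"
      using that by (auto simp: merged_def cluster_def)
    with that show ?thesis by (simp add: merged_def)
  qed
  have "labels ?t = insert i ?L"
    using assms by (auto simp: merged_def)
  then have "distortion X ?t = sum (?f ?t) (insert i ?L)"
    using distortion_eq_sum_sse [of X "labels ?t" ?t]
      well_labelled_merged [OF assms(3,5,2)] assms(1) by (simp add: well_labelled_def)
  also have "\<dots> = ?f ?t i + sum (?f s) ?L"
    using fin rest by (subst sum.insert) auto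
  finally have t: "distortion X ?t = ?f ?t i + sum (?f s) ?L" .
  have "distortion X s = sum (?f s) (labels s)"
    using distortion_eq_sum_sse [of X "labels s" s] assms by (simp add: well_labelled_def)
  also have "\<dots> = ?f s i + ?f s j + sum (?f s) ?L"
    using sum.remove [of "labels s" i "?f s"] sum.remove [of "labels s - {i}" j "?f s"] fin assms
    by (simp add: Diff_insert2 [symmetric] insert_commute)
  finally have s: "distortion X s = ?f s i + ?f s j + sum (?f s) ?L" .
  have dist: "distortion X ?t = distortion X s + merge_change X s i j
      + real (card X) / real (card (labels s))"
    unfolding t s cl_i merge_change_def Let_def by (simp add: merged_def)
  \<comment> \<open>With \<open>Suc k\<close> labels before and \<open>k\<close> after,
    \<open>harm\<close> loses \<open>1 / Suc k\<close>, the reciprocal of the old count used in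
    \<open>merge_change\<close>.\<close>
  obtain k where k: "card (labels s) = Suc k"
    using fin assms by (metis card_Suc_Diff1)
  then have "card (labels ?t) = k"
    using fin assms by (simp add: merged_def)
  with dist k show ?thesis
    by (simp add: potential_def harm_Suc field_simps)
qed

lemma centred_merged:
  assumes "centred X s" "i \<noteq> j"
  shows "centred X (merged X i j s)"
  unfolding centred_def
proof
  fix x assume x: "x \<in> X"
  let ?t = "merged X i j s"
  show "centroid ?t (label ?t x) = mean (cluster X ?t (label ?t x))"
  proof (cases "label s x \<in> {i, j}")
    case True
    then have "cluster X ?t (label ?t x) = cluster X s i \<union> cluster X s j"
      using assms by (auto simp: merged_def cluster_def)
    with True show ?thesis
      by (auto simp: merged_def)
  next
    case False
    then have "cluster X ?t (label ?t x) = cluster X s (label s x)"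
      by (auto simp: merged_def cluster_def)
    with False x assms(1) show ?thesis
      by (auto simp: merged_def centred_def)
  qed
qed

lemma maybe_merge_cases:
  assumes "maybe_merge X s t"
  obtains "t = s"
    | i j where "i \<in> labels s" "j \<in> labels s" "i \<noteq> j" "merge_change X s i j < 0"
        "t = merged X i j s"
proof (cases "t = s")
  case False
  with assms obtain i j where "closest_pair s i j" "merge_change X s i j < 0" "t = merged X i j s"
    unfolding maybe_merge_def by metis
  with that(2) show ?thesis
    by (auto simp: closest_pair_def)
qed (rule that)

section \<open>Descent over a whole cycle\<close>

text \<open>A split or merge lowers the potential strictly, even if no label of a point changes.
  Without either, a changed assignment must stem from one of the two \<open>k\<close>-means steps,
  and that step is strict.\<close>

lemma kstar_cycle_properties:
  fixes X :: "'a::euclidean_space set"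
  assumes "finite X" "kstar_cycle X s t" "well_labelled X s"
  shows "centred X t"
    and "\<not> assignment_unchanged X s t \<Longrightarrow> potential X t < potential X s"
proof -
  obtain r where r: "kmeans_step X s r"
    and rt: "split_step X r t \<or> no_split X r \<and> (\<exists>u. kmeans_step X r u \<and> maybe_merge X u t)"
    using assms by (auto simp: kstar_cycle_def)
  have wr: "well_labelled X r"
    using r assms well_labelled_kmeans_step by blast
  note km_r = kmeans_step_properties [OF assms(1) r assms(3)]
  have "centred X t \<and>
      (\<not> assignment_unchanged X s t \<longrightarrow> potential X t < potential X s)"
    using rt
  proof (elim disjE conjE exE)
    assume "split_step X r t"
    then obtain j j' where j: "j \<in> labels r" "split_change X r j < 0" "split_into X j j' r t"
      by (auto simp: split_step_def)
    have "centred X t"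
      using centred_split_into [OF wr km_r(1) j(1,3)] km_r(4) j(1) by blast
    moreover have "potential X t < potential X s"
      using potential_split_into [OF assms(1) wr j(1,3)] j(2) km_r(2) by linarith
    ultimately show ?thesis by auto
  next
    fix u assume u: "kmeans_step X r u" and merge: "maybe_merge X u t"
    have wu: "well_labelled X u"
      using u wr well_labelled_kmeans_step by blast
    note km_u = kmeans_step_properties [OF assms(1) u wr]
    from merge show ?thesis
    proof (cases rule: maybe_merge_cases)
      case 1
      have "potential X u < potential X s" if "\<not> assignment_unchanged X s u"
      proof -
        have "(\<exists>x\<in>X. label r x \<noteq> label s x) \<or> (\<exists>x\<in>X. label u x \<noteq> label r x)"
          using that by (auto simp: assignment_unchanged_def)
        with km_r(2,3) km_u(2,3) show ?thesis by fastforce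
      qed
      with 1 km_u(1) show ?thesis by auto
    next
      case (2 i j)
      have "potential X t < potential X s"
        using potential_merged [OF assms(1) wu 2(1-3)] 2(4,5) km_r(2) km_u(2) by simp
      with 2 centred_merged km_u(1) show ?thesis by auto
    qed
  qed
  then show "centred X t" "\<not> assignment_unchanged X s t \<Longrightarrow> potential X t < potential X s"
    by auto
qed

section \<open>Finitely many potential values and termination\<close>

lemma bounded_harm_finite: "finite {k. harm k \<le> (c :: real)}"
proof -
  have "\<forall>\<^sub>F k in sequentially. c < harm k"
    using harm_at_top by (simp add: filterlim_at_top_dense)
  then obtain K where "\<And>k. K \<le> k \<Longrightarrow> c < harm k"
    by (auto simp: eventually_sequentially)
  then have "{k. harm k \<le> c} \<subseteq> {..<K}"
    by (auto simp: not_less [symmetric])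
  then show ?thesis
    using finite_subset by blast
qed

text \<open>In a centred state the potential depends only on the same-cluster relation on
  \<open>X\<close> and the number of labels. There are finitely many such relations, and the bound
  \<open>c\<close> limits the number of labels.\<close>

lemma finite_centred_potentials:
  fixes X :: "'a::euclidean_space set"
  assumes "finite X" "X \<noteq> {}"
  shows "finite (potential X ` {s. centred X s \<and> potential X s \<le> c})"
proof -
  define N where "N = real (card X)"
  have N: "N > 0"
    using assms by (simp add: N_def card_gt_0_iff)
  \<comment> \<open>\<open>R\<close> stands for the same-cluster relation, so its image of
    \<open>x\<close> is the cluster of \<open>x\<close>; this encoding is insensitive to the names
    of the labels.\<close>
  define val where "val = (\<lambda>(R, k). (\<Sum>x\<in>X. (norm (x - mean (R `` {x})))\<^sup>2) + N * harm k)"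
  have "potential X s \<in> val ` (Pow (X \<times> X) \<times> {k. harm k \<le> c / N})"
    if s: "centred X s" "potential X s \<le> c" for s
  proof -
    define R where "R = {(x, y) \<in> X \<times> X. label s y = label s x}"
    have "R `` {x} = cluster X s (label s x)" if "x \<in> X" for x
      using that by (auto simp: R_def cluster_def)
    then have "potential X s = val (R, card (labels s))"
      using s(1) by (simp add: potential_def distortion_def centred_def val_def N_def)
    \<comment> \<open>The nonnegative distortion is dropped and the remaining inequality divided by
      \<open>N\<close>.\<close>
    moreover have "harm (card (labels s)) \<le> c / N"
      using s(2) N distortion_nonneg [of X s]
      by (simp add: potential_def N_def [symmetric] field_simps)
    moreover have "R \<subseteq> X \<times> X"
      by (auto simp: R_def)
    ultimately show ?thesis by auto
  qed
  then have "potential X ` {s. centred X s \<and> potential X s \<le> c}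
      \<subseteq> val ` (Pow (X \<times> X) \<times> {k. harm k \<le> c / N})"
    by auto
  then show ?thesis
    by (rule finite_subset) (use assms bounded_harm_finite in simp)
qed

text \<open>Otherwise the potentials would form an infinite strictly decreasing sequence inside a
  finite set.\<close>

lemma assignment_eventually_unchanged:
  fixes X :: "'a::euclidean_space set"
  assumes "finite X" "well_labelled X (\<sigma> 0)" "\<And>i. kstar_cycle X (\<sigma> i) (\<sigma> (Suc i))"
  shows "\<exists>n. assignment_unchanged X (\<sigma> n) (\<sigma> (Suc n))"
proof (rule ccontr)
  assume "\<nexists>n. assignment_unchanged X (\<sigma> n) (\<sigma> (Suc n))"
  then have changed: "\<not> assignment_unchanged X (\<sigma> n) (\<sigma> (Suc n))" for n
    by blast
  \<comment> \<open>Without points, every cycle leaves the assignment unchanged vacuously.\<close>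
  then have "X \<noteq> {}"
    by (auto simp: assignment_unchanged_def)
  have well: "well_labelled X (\<sigma> n)" for n
    by (induction n) (use assms well_labelled_kstar_cycle in blast)+
  \<comment> \<open>The shift by one skips the starting state: centredness is known only at the end
    of a cycle.\<close>
  define p where "p = (\<lambda>n. potential X (\<sigma> (Suc n)))"
  have "p (Suc n) < p n" for n
    using kstar_cycle_properties(2) [OF assms(1,3) well changed] by (simp add: p_def)
  then have mono: "strict_mono (\<lambda>n. - p n)"
    by (simp add: strict_mono_Suc_iff)
  then have "inj p"
    using strict_mono_imp_inj_on [OF mono, of UNIV] by (simp add: inj_on_def)
  moreover have "p n \<le> p 0" for n
    using strict_mono_less_eq [OF mono, of 0 n] by simp
  then have "range p \<subseteq> potential X ` {s. centred X s \<and> potential X s \<le> p 0}"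
    using kstar_cycle_properties(1) [OF assms(1,3) well] by (auto simp: p_def)
  then have "finite (range p)"
    using finite_centred_potentials [OF assms(1) \<open>X \<noteq> {}\<close>] finite_subset by blast
  ultimately show False
    using finite_imageD infinite_UNIV_nat by blast
qed

text \<open>A run can start, never gets stuck, and meets the stopping criterion however random
  choices and ties are resolved. The first two claims keep the third from holding vacuously.\<close>

theorem theorem3:
  fixes X :: "(real ^ 'd) set"
  assumes "finite X"
  shows "(\<exists>s. initial X s) \<and>
    (\<forall>s t. initial X s \<and> (kstar_cycle X)\<^sup>*\<^sup>* s t \<longrightarrow> (\<exists>u. kstar_cycle X t u)) \<and>
    (\<forall>\<sigma>. initial X (\<sigma> 0) \<and> (\<forall>i. kstar_cycle X (\<sigma> i) (\<sigma> (Suc i))) \<longrightarrow>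
       (\<exists>n. assignment_unchanged X (\<sigma> n) (\<sigma> (Suc n))))"
proof (intro conjI allI impI)
  show "\<exists>s. initial X s"
    by (rule initial_exists)
next
  fix s t assume "initial X s \<and> (kstar_cycle X)\<^sup>*\<^sup>* s t"
  then have "(kstar_cycle X)\<^sup>*\<^sup>* s t" "well_labelled X s"
    using well_labelled_initial by auto
  then have "well_labelled X t"
    by (induction rule: rtranclp_induct) (auto intro: well_labelled_kstar_cycle)
  then show "\<exists>u. kstar_cycle X t u"
    by (rule kstar_cycle_exists)
next
  fix \<sigma> assume "initial X (\<sigma> 0) \<and> (\<forall>i. kstar_cycle X (\<sigma> i) (\<sigma> (Suc i)))"
  then show "\<exists>n. assignment_unchanged X (\<sigma> n) (\<sigma> (Suc n))"
    using assms well_labelled_initial by (intro assignment_eventually_unchanged) auto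
qed

end
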